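(* Let $n$ be a positive integer, let $A,B\in \mathbb{C}^{n\times n}$ with $A$ diagonalizable, and let $C=A+B$. (i) If $C$ is diagonalizable and $|\Lambda(A)\setminus \Lambda(C)|\geq 1$, then $$|\Lambda(C)|\leq (r(B)+1)|\Lambda(A)|-1.$$ Specifically, if $C$ is diagonalizable and $\Lambda(A)\cap\Lambda(C)=\emptyset$, then $$|\Lambda(C)|\leq r(B)|\Lambda(A)|.$$ (ii) If $C$ is non-diagonalizable and $|\Lambda(A)\setminus \Lambda(C)|\geq 1$, then $$|\Lambda(C)|\leq (r(B)+1)|\Lambda(A)|-2.$$ Specifically, if $C$ is non-diagonalizable and $\Lambda(A)\cap\Lambda(C)=\emptyset$, then $$|\Lambda(C)|\leq r(B)|\Lambda(A)|-1.$$
   Context: For $M\in\mathbb{C}^{n\times n}$: $r(M)$ is the rank of $M$; $\Lambda(M)$ is the set of all distinct eigenvalues of $M$ in $\mathbb{C}$, and $|\cdot|$ denotes the cardinality of a finite set. Diagonalizable means diagonalizable over $\mathbb{C}$. *)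

theory Defs
  imports
    "Jordan_Normal_Form.Spectral_Radius"
    "Jordan_Normal_Form.DL_Rank"
begin

(* similar_mat only relates square matrices of equal dimension, so D is square of the size of A. *)
definition diagonalizable :: "complex mat \<Rightarrow> bool" where
  "diagonalizable A \<longleftrightarrow> (\<exists>D. diagonal_mat D \<and> similar_mat A D)"

end

theory Submission
  imports Defs "Jordan_Normal_Form.Jordan_Normal_Form_Uniqueness"
begin

text \<open>Write \<open>g\<^sub>X(\<mu>)\<close> for the geometric multiplicity of \<open>\<mu>\<close> in \<open>X\<close>. The sum of \<open>g\<^sub>X\<close> over the
  spectrum is at most \<open>n\<close>, with equality iff \<open>X\<close> is diagonalizable, and subadditivity of the rank
  gives \<open>g\<^sub>A \<le> g\<^sub>C + r(B)\<close>. Summing the latter over \<open>\<Lambda>(A)\<close> yields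
  \<open>n \<le> r(B) |\<Lambda>(A)| + (\<Sum>\<mu>\<in>\<Lambda>(A) \<inter> \<Lambda>(C). g\<^sub>C(\<mu>))\<close>, while every eigenvalue in \<open>\<Lambda>(C) - \<Lambda>(A)\<close> takes up at
  least one of the remaining dimensions of \<open>C\<close>.\<close>

section \<open>Geometric multiplicity and rank\<close>

definition geo_mult :: "'a::field mat \<Rightarrow> 'a \<Rightarrow> nat" where
  "geo_mult A \<mu> = kernel_dim (char_matrix A \<mu>)"

text \<open>The image of \<open>\<lambda>v. A *\<^sub>v v\<close> is the column space and its kernel
  is \<open>mat_kernel A\<close>, so rank-nullity for linear maps carries over to matrices.\<close>

lemma (in vec_space) rank_add_kernel_dim:
  assumes A: "A \<in> carrier_mat n nc"
  shows "rank A + kernel_dim A = nc"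
proof -
  interpret K: kernel n nc A by unfold_locales (rule A)
  interpret L: linear_map class_ring "module_vec TYPE('a) nc" V "\<lambda>v. A *\<^sub>v v"
    by unfold_locales
      (use A mult_add_distrib_mat_vec[OF A] mult_mat_vec[OF A] in
        \<open>auto simp: module_hom_def module_vec_simps class_ring_simps\<close>)
  have im: "L.imT = span (set (cols A))"
    using col_space_eq[OF A] A
    unfolding L.im_def col_space_def by (auto simp: module_vec_simps)
  have ker: "L.kerT = mat_kernel A"
    using A unfolding L.ker_def mat_kernel[OF A] by (auto simp: module_vec_simps)
  show ?thesis
    using L.rank_nullity[OF K.NC.fin_dim] 
    unfolding im ker rank_def K.kernel_dim K.NC.dim_is_n by simp
qed

text \<open>By rank-nullity, a trivial kernel of \<open>char_matrix A \<mu>\<close> means full rank,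
  hence nonzero determinant. Thus \<open>geo_mult\<close> vanishes off the spectrum and is at least
  1 on it.\<close>

lemma geo_mult_eq_0_iff:
  assumes A: "(A :: 'a::field mat) \<in> carrier_mat n n"
  shows "geo_mult A \<mu> = 0 \<longleftrightarrow> \<mu> \<notin> spectrum A"
proof -
  interpret vec_space "TYPE('a)" n .
  have M: "char_matrix A \<mu> \<in> carrier_mat n n" using A by simp
  show ?thesis
    using rank_add_kernel_dim[OF M] det_rank_iff[OF M] eigenvalue_det[OF A, of \<mu>]
    by (auto simp: geo_mult_def spectrum_def)
qed

text \<open>Adding \<open>B\<close> raises the rank of the characteristic matrix by at most the rank
  of \<open>B\<close>, and by rank-nullity the kernel shrinks by no more than that.\<close>

lemma geo_mult_le_add_rank:
  assumes A: "(A :: 'a::field mat) \<in> carrier_mat n n" and B: "B \<in> carrier_mat n n"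
  shows "geo_mult A \<mu> \<le> geo_mult (A + B) \<mu> + vec_space.rank n B"
proof -
  interpret vec_space "TYPE('a)" n .
  have M: "char_matrix A \<mu> \<in> carrier_mat n n" "char_matrix (A + B) \<mu> \<in> carrier_mat n n"
    using A B by auto
  have eq: "char_matrix (A + B) \<mu> = char_matrix A \<mu> + B"
    using A B by (intro eq_matI) (auto simp: char_matrix_def)
  have "rank (char_matrix (A + B) \<mu>) \<le> rank (char_matrix A \<mu>) + rank B"
    unfolding eq by (rule rank_subadditive[OF M(1) B])
  then show ?thesis
    using rank_add_kernel_dim[OF M(1)] rank_add_kernel_dim[OF M(2)]
    by (simp add: geo_mult_def)
qed

section \<open>Geometric multiplicities and Jordan blocks\<close>

lemma jordan_matrix_map_Pair_1:
  "jordan_matrix (map (Pair 1) as) =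
     mat (length as) (length as) (\<lambda>(i, j). if i = j then as ! i else 0)"
proof (induction as)
  case Nil
  show ?case by (intro eq_matI) (auto simp: jordan_matrix_def)
next
  case (Cons a as)
  then show ?case
    unfolding jordan_matrix_def
    by (intro eq_matI) (auto simp: Let_def nth_Cons')
qed

text \<open>A diagonal matrix is a Jordan matrix whose blocks all have size 1, so diagonalizability
  becomes a condition on block sizes.\<close>

lemma diagonalizable_iff_jordan_nf:
  "diagonalizable A \<longleftrightarrow> (\<exists>as. jordan_nf A (map (Pair 1) as))"
proof
  assume "diagonalizable A"
  then obtain D where D: "diagonal_mat D" "similar_mat A D"
    by (auto simp: diagonalizable_def)
  obtain n where n: "D \<in> carrier_mat n n"
    using similar_matD[OF D(2)] by blast
  have "D = jordan_matrix (map (Pair 1) (map (\<lambda>i. D $$ (i, i)) [0..<n]))"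
    using n D(1) unfolding jordan_matrix_map_Pair_1
    by (intro eq_matI) (auto simp: diagonal_mat_def)
  then have "jordan_nf A (map (Pair 1) (map (\<lambda>i. D $$ (i, i)) [0..<n]))"
    using D(2) by (auto simp: jordan_nf_def)
  then show "\<exists>as. jordan_nf A (map (Pair 1) as)" by blast
next
  assume "\<exists>as. jordan_nf A (map (Pair 1) as)"
  then obtain as where "similar_mat A (jordan_matrix (map (Pair 1) as))"
    by (auto simp: jordan_nf_def)
  moreover have "diagonal_mat (jordan_matrix (map (Pair 1) as))"
    unfolding jordan_matrix_map_Pair_1 by (simp add: diagonal_mat_def)
  ultimately show "diagonalizable A"
    unfolding diagonalizable_def by blast
qed

text \<open>The eigenspace is the generalized eigenspace of order 1, to which each Jordan block with
  eigenvalue \<mu> contributes exactly one dimension.\<close>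

lemma geo_mult_jordan_nf:
  assumes A: "A \<in> carrier_mat n n" and jnf: "jordan_nf A n_as"
  shows "geo_mult A \<mu> = length (filter (\<lambda>p. snd p = \<mu>) n_as)"
proof -
  have pos: "0 \<notin> fst ` set n_as" and sim: "similar_mat A (jordan_matrix n_as)"
    using jnf by (auto simp: jordan_nf_def)
  have "geo_mult A \<mu> = dim_gen_eigenspace A \<mu> 1"
    using A by (simp add: geo_mult_def dim_gen_eigenspace_def)
  also have "\<dots> = (\<Sum>m\<leftarrow>map fst (filter (\<lambda>(m, e). e = \<mu>) n_as). min 1 m)"
    unfolding dim_gen_eigenspace_similar[OF sim] by (rule dim_gen_eigenspace_jordan_matrix)
  \<comment> \<open>Block sizes are positive, so every summand \<open>min 1 m\<close> is 1.\<close>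
  also have "\<dots> = length (filter (\<lambda>p. snd p = \<mu>) n_as)"
    using pos by (induction n_as) auto
  finally show ?thesis .
qed

lemma length_eq_sum_length_filter:
  assumes "finite S" "f ` set xs \<subseteq> S"
  shows "length xs = (\<Sum>y\<in>S. length (filter (\<lambda>x. f x = y) xs))"
  using assms(2)
proof (induction xs)
  case (Cons x xs)
  have "(\<Sum>y\<in>S. length (filter (\<lambda>z. f z = y) (x # xs))) =
      (\<Sum>y\<in>S. (if f x = y then 1 else 0) + length (filter (\<lambda>z. f z = y) xs))"
    by (intro sum.cong) auto
  then show ?case
    using Cons assms(1) by (simp add: sum.distrib)
qed simp

text \<open>Each block is counted once, at its own eigenvalue, which lies in the spectrum because
  its geometric multiplicity is nonzero.\<close>

lemma sum_geo_mult_jordan_nf: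
  assumes A: "A \<in> carrier_mat n n" and jnf: "jordan_nf A n_as"
  shows "(\<Sum>\<mu>\<in>spectrum A. geo_mult A \<mu>) = length n_as"
proof -
  have "snd ` set n_as \<subseteq> spectrum A"
  proof
    fix \<mu> assume "\<mu> \<in> snd ` set n_as"
    then have "geo_mult A \<mu> \<noteq> 0"
      by (auto simp: geo_mult_jordan_nf[OF A jnf] filter_empty_conv)
    then show "\<mu> \<in> spectrum A" by (simp add: geo_mult_eq_0_iff[OF A])
  qed
  from length_eq_sum_length_filter[OF card_finite_spectrum(1)[OF A] this]
  show ?thesis by (simp add: geo_mult_jordan_nf[OF A jnf])
qed

lemma jordan_nf_sum_sizes:
  assumes A: "A \<in> carrier_mat n n" and jnf: "jordan_nf A n_as"
  shows "sum_list (map fst n_as) = n"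
proof -
  have "similar_mat A (jordan_matrix n_as)" using jnf by (simp add: jordan_nf_def)
  from similar_matD[OF this] obtain m
    where "A \<in> carrier_mat m m" "jordan_matrix n_as \<in> carrier_mat m m" by blast
  then show ?thesis using A by (metis carrier_matD(1) jordan_matrix_dim(1))
qed

text \<open>Meant for lists of Jordan block sizes; the second claim is the equality case, which
  forces every block to have size 1.\<close>

lemma length_le_sum_list_pos:
  assumes "0 \<notin> set (xs :: nat list)"
  shows "length xs \<le> sum_list xs" "length xs = sum_list xs \<Longrightarrow> x \<in> set xs \<Longrightarrow> x = 1"
proof -
  have "length xs \<le> sum_list xs \<and> (length xs = sum_list xs \<longrightarrow> (\<forall>x\<in>set xs. x = 1))"
    using assms
  proof (induction xs)
    case (Cons x xs)
    then have IH: "length xs \<le> sum_list xs" "x \<ge> 1"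
      and ones: "length xs = sum_list xs \<Longrightarrow> \<forall>x\<in>set xs. x = 1"
      by auto
    show ?case
    proof (intro conjI impI)
      show "length (x # xs) \<le> sum_list (x # xs)" using IH by simp
      assume "length (x # xs) = sum_list (x # xs)"
      then have "length xs = sum_list xs" "x = 1" using IH by auto
      then show "\<forall>y\<in>set (x # xs). y = 1" using ones by simp
    qed
  qed simp
  then show "length xs \<le> sum_list xs" "length xs = sum_list xs \<Longrightarrow> x \<in> set xs \<Longrightarrow> x = 1"
    by auto
qed

text \<open>Over the complex numbers the characteristic polynomial splits into linear factors, which
  guarantees a Jordan normal form.\<close>

lemma complex_jordan_nf_exists:
  assumes A: "(A :: complex mat) \<in> carrier_mat n n"
  shows "\<exists>n_as. jordan_nf A n_as"
  using char_poly_factorized[OF A] jordan_nf_exists[OF A] by blast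

text \<open>The sum counts Jordan blocks, and these have positive sizes adding up to
  \<open>n\<close>.\<close>

lemma sum_geo_mult_le:
  assumes A: "(A :: complex mat) \<in> carrier_mat n n"
  shows "(\<Sum>\<mu>\<in>spectrum A. geo_mult A \<mu>) \<le> n"
proof -
  obtain n_as where jnf: "jordan_nf A n_as"
    using complex_jordan_nf_exists[OF A] by blast
  then have "0 \<notin> set (map fst n_as)" by (simp add: jordan_nf_def)
  from length_le_sum_list_pos(1)[OF this] show ?thesis
    by (simp add: sum_geo_mult_jordan_nf[OF A jnf] jordan_nf_sum_sizes[OF A jnf])
qed

text \<open>The number of blocks reaches the sum \<open>n\<close> of their sizes exactly when all
  sizes are 1.\<close>

lemma diagonalizable_iff_sum_geo_mult:
  assumes A: "A \<in> carrier_mat n n"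
  shows "diagonalizable A \<longleftrightarrow> (\<Sum>\<mu>\<in>spectrum A. geo_mult A \<mu>) = n"
proof
  assume "diagonalizable A"
  then obtain as where jnf: "jordan_nf A (map (Pair 1) as)"
    by (auto simp: diagonalizable_iff_jordan_nf)
  have "sum_list (map fst (map (Pair (1::nat)) as)) = length as"
    by (induction as) auto
  then show "(\<Sum>\<mu>\<in>spectrum A. geo_mult A \<mu>) = n"
    using sum_geo_mult_jordan_nf[OF A jnf] jordan_nf_sum_sizes[OF A jnf] by simp
next
  assume eq: "(\<Sum>\<mu>\<in>spectrum A. geo_mult A \<mu>) = n"
  obtain n_as where jnf: "jordan_nf A n_as"
    using complex_jordan_nf_exists[OF A] by blast
  have "0 \<notin> set (map fst n_as)" using jnf by (simp add: jordan_nf_def)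
  moreover have "length (map fst n_as) = sum_list (map fst n_as)"
    using eq sum_geo_mult_jordan_nf[OF A jnf] jordan_nf_sum_sizes[OF A jnf] by simp
  ultimately have "x = 1" if "x \<in> set (map fst n_as)" for x
    using length_le_sum_list_pos(2) that by blast
  then have "n_as = map (Pair 1) (map snd n_as)"
    by (intro nth_equalityI) (auto simp: prod_eq_iff)
  with jnf show "diagonalizable A"
    unfolding diagonalizable_iff_jordan_nf by metis
qed

section \<open>Counting the eigenvalues of the sum\<close>

text \<open>The common estimate behind all four bounds. The last sum is left unevaluated because it
  equals \<open>n\<close> or is smaller according to whether \<open>A + B\<close> is
  diagonalizable.\<close>

lemma card_spectrum_add_le:
  assumes A: "A \<in> carrier_mat n n" and B: "B \<in> carrier_mat n n" and "diagonalizable A"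
  shows "card (spectrum (A + B)) + n \<le> card (spectrum A \<inter> spectrum (A + B))
    + vec_space.rank n B * card (spectrum A)
    + (\<Sum>\<mu>\<in>spectrum (A + B). geo_mult (A + B) \<mu>)"
proof -
  let ?C = "A + B" and ?r = "vec_space.rank n B"
  let ?I = "spectrum A \<inter> spectrum ?C" and ?N = "spectrum ?C - spectrum A"
  have C: "?C \<in> carrier_mat n n" using A B by simp
  note fin = card_finite_spectrum(1)[OF A] card_finite_spectrum(1)[OF C]
  have "n = (\<Sum>\<mu>\<in>spectrum A. geo_mult A \<mu>)"
    using assms diagonalizable_iff_sum_geo_mult[OF A] by simp
  also have "\<dots> \<le> (\<Sum>\<mu>\<in>spectrum A. geo_mult ?C \<mu> + ?r)"
    by (intro sum_mono geo_mult_le_add_rank[OF A B])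
  also have "\<dots> = (\<Sum>\<mu>\<in>spectrum A. geo_mult ?C \<mu>) + ?r * card (spectrum A)"
    by (simp add: sum.distrib)
  \<comment> \<open>Eigenvalues of \<open>A\<close> that are not eigenvalues of \<open>?C\<close>
    contribute 0.\<close>
  also have "(\<Sum>\<mu>\<in>spectrum A. geo_mult ?C \<mu>) = (\<Sum>\<mu>\<in>?I. geo_mult ?C \<mu>)"
    using fin by (intro sum.mono_neutral_right) (auto simp: geo_mult_eq_0_iff[OF C])
  finally have n: "n \<le> (\<Sum>\<mu>\<in>?I. geo_mult ?C \<mu>) + ?r * card (spectrum A)" .
  have "card ?N = (\<Sum>\<mu>\<in>?N. 1)" by simp
  also have "\<dots> \<le> (\<Sum>\<mu>\<in>?N. geo_mult ?C \<mu>)"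
    using geo_mult_eq_0_iff[OF C] by (intro sum_mono) (auto simp: Suc_le_eq)
  finally have N: "card ?N \<le> (\<Sum>\<mu>\<in>?N. geo_mult ?C \<mu>)" .
  have split: "spectrum ?C = ?I \<union> ?N" "?I \<inter> ?N = {}" by auto
  have "card (spectrum ?C) = card ?I + card ?N"
    by (subst split(1), rule card_Un_disjoint) (use fin in auto)
  moreover have "(\<Sum>\<mu>\<in>spectrum ?C. geo_mult ?C \<mu>) =
      (\<Sum>\<mu>\<in>?I. geo_mult ?C \<mu>) + (\<Sum>\<mu>\<in>?N. geo_mult ?C \<mu>)"
    by (subst split(1), rule sum.union_disjoint) (use fin in auto)
  \<comment> \<open>Adding \<open>n\<close> and \<open>N\<close> reassembles the full sum over
    \<open>spectrum ?C\<close> on the right; adding \<open>card ?I\<close> to both sides completes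
    \<open>card (spectrum ?C)\<close> on the left.\<close>
  ultimately show ?thesis using n N by linarith
qed

theorem theorem2p5:
  fixes n :: nat and A B C :: "complex mat"
  assumes "n > 0"
    and "A \<in> carrier_mat n n"
    and "B \<in> carrier_mat n n"
    and "diagonalizable A"
    and "C = A + B"
  shows
    "(diagonalizable C \<and> card (spectrum A - spectrum C) \<ge> 1 \<longrightarrow>
        int (card (spectrum C)) \<le> (int (vec_space.rank n B) + 1) * int (card (spectrum A)) - 1) \<and>
     (diagonalizable C \<and> spectrum A \<inter> spectrum C = {} \<longrightarrow>
        int (card (spectrum C)) \<le> int (vec_space.rank n B) * int (card (spectrum A))) \<and>
     (\<not> diagonalizable C \<and> card (spectrum A - spectrum C) \<ge> 1 \<longrightarrow>
        int (card (spectrum C)) \<le> (int (vec_space.rank n B) + 1) * int (card (spectrum A)) - 2) \<and>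
     (\<not> diagonalizable C \<and> spectrum A \<inter> spectrum C = {} \<longrightarrow>
        int (card (spectrum C)) \<le> int (vec_space.rank n B) * int (card (spectrum A)) - 1)"
proof -
  let ?r = "vec_space.rank n B" and ?s = "\<Sum>\<mu>\<in>spectrum C. geo_mult C \<mu>"
  have C: "C \<in> carrier_mat n n" using assms by simp
  have "card (spectrum C) + n \<le> card (spectrum A \<inter> spectrum C) + ?r * card (spectrum A) + ?s"
    using card_spectrum_add_le assms by blast
  \<comment> \<open>Over the integers the bounds with -1 and -2 involve no truncated
    subtraction.\<close>
  then have main: "int (card (spectrum C)) + int n \<le>
      int (card (spectrum A \<inter> spectrum C)) + int ?r * int (card (spectrum A)) + int ?s"
    unfolding of_nat_mult[symmetric] of_nat_add[symmetric] of_nat_le_iff .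
  have split: "card (spectrum A) = card (spectrum A \<inter> spectrum C) + card (spectrum A - spectrum C)"
    using card_finite_spectrum(1)[OF assms(2)] by (rule card_Int_Diff)
  have dist: "(int ?r + 1) * int (card (spectrum A)) =
      int ?r * int (card (spectrum A)) + int (card (spectrum A))"
    by (simp add: algebra_simps)
  have diag: "?s = n" if "diagonalizable C"
    using that diagonalizable_iff_sum_geo_mult[OF C] by simp
  \<comment> \<open>This strict inequality is the source of the extra 1 subtracted in the
    non-diagonalizable bounds.\<close>
  have nondiag: "?s < n" if "\<not> diagonalizable C"
    using that diagonalizable_iff_sum_geo_mult[OF C] sum_geo_mult_le[OF C] by simp
  show ?thesis
  proof (intro conjI impI; elim conjE)
    assume "diagonalizable C" "1 \<le> card (spectrum A - spectrum C)"
    \<comment> \<open>Some eigenvalue of \<open>A\<close> is not one of \<open>C\<close>, so the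
      intersection has at most \<open>card (spectrum A) - 1\<close> elements; this supplies the
      -1.\<close>
    then show "int (card (spectrum C)) \<le> (int ?r + 1) * int (card (spectrum A)) - 1"
      using main split diag unfolding dist by linarith
  next
    assume "diagonalizable C" "spectrum A \<inter> spectrum C = {}"
    then show "int (card (spectrum C)) \<le> int ?r * int (card (spectrum A))"
      using main diag by simp
  next
    assume "\<not> diagonalizable C" "1 \<le> card (spectrum A - spectrum C)"
    then show "int (card (spectrum C)) \<le> (int ?r + 1) * int (card (spectrum A)) - 2"
      using main split nondiag unfolding dist by linarith
  next
    assume "\<not> diagonalizable C" "spectrum A \<inter> spectrum C = {}"
    then show "int (card (spectrum C)) \<le> int ?r * int (card (spectrum A)) - 1"
      \<comment> \<open>Reversing \<open>of_nat_sum\<close> keeps \<open>int\<close> outside the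
        sum, in the form where \<open>nondiag\<close> applies.\<close>
      using main nondiag by (simp flip: of_nat_sum)
  qed
qed

end
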